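(* Let $G$ be a non-abelian group with centre $\mathcal{Z}(G)$. If the index $|G:\mathcal{Z}(G)|$ is finite and is a product of at most $3$ primes, not necessarily distinct, then the commuting graph of $G$ is disconnected.
   Context: The commuting graph of a group $G$ is the simple undirected graph whose vertices are the non-central elements of $G$, with two distinct vertices $x,y$ adjacent if and only if $xy=yx$. A graph is connected if and only if there is a path between any two distinct vertices, and disconnected otherwise. *)

theory Defs
  imports
    "HOL-Algebra.Coset"
    "HOL-Computational_Algebra.Primes"
    "Graph_Theory.Graph_Theory"
begin

definition group_center :: "('a, 'b) monoid_scheme \<Rightarrow> 'a set" where
  "group_center G =
     {z \<in> carrier G. \<forall>g \<in> carrier G. z \<otimes>\<^bsub>G\<^esub> g = g \<otimes>\<^bsub>G\<^esub> z}"

text \<open>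
  As usual in \<^theory>\<open>Graph_Theory.Graph_Theory\<close>, a simple undirected graph is a loop-free
  symmetric digraph whose arcs are ordered pairs of vertices. The library locale \<^locale>\<open>graph\<close>
  also demands a finite vertex set, which is not wanted here.
\<close>

definition commuting_graph :: "('a, 'b) monoid_scheme \<Rightarrow> 'a pair_pre_digraph" where
  "commuting_graph G =
     \<lparr> pverts = carrier G - group_center G,
       parcs = {(x, y). x \<in> carrier G - group_center G \<and> y \<in> carrier G - group_center G \<and>
                  x \<noteq> y \<and> x \<otimes>\<^bsub>G\<^esub> y = y \<otimes>\<^bsub>G\<^esub> x} \<rparr>"

lemma pair_loopfree_commuting_graph: "pair_loopfree_digraph (commuting_graph G)"
  by unfold_locales (auto simp: commuting_graph_def)

lemma symmetric_commuting_graph: "symmetric (with_proj (commuting_graph G))"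
  by (auto simp: symmetric_conv commuting_graph_def)

text \<open>
  The library's \<^const>\<open>Digraph_Component.connected\<close> excludes the graph without vertices. This does
  not matter for the commuting graph of a non-abelian group, where it means that any two distinct
  vertices are joined by a path.
\<close>

lemma commuting_graph_nonempty:
  assumes "group G" "\<not> comm_group G"
  shows "pverts (commuting_graph G) \<noteq> {}"
  using assms group.group_comm_groupI[of G] by (fastforce simp: commuting_graph_def group_center_def)

lemma connected_commuting_graph_iff:
  assumes "group G" "\<not> comm_group G"
  shows "Digraph_Component.connected (with_proj (commuting_graph G)) \<longleftrightarrow>
    (\<forall>x \<in> pverts (commuting_graph G). \<forall>y \<in> pverts (commuting_graph G). x \<noteq> y \<longrightarrow>
       (\<exists>p. pre_digraph.apath (with_proj (commuting_graph G)) x p y))"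
proof -
  interpret pair_loopfree_digraph "commuting_graph G"
    by (rule pair_loopfree_commuting_graph)
  have "mk_symmetric (with_proj (commuting_graph G)) = commuting_graph G"
    by (auto simp: mk_symmetric_def commuting_graph_def)
  then have "Digraph_Component.connected (with_proj (commuting_graph G)) \<longleftrightarrow>
      strongly_connected (with_proj (commuting_graph G))"
    by (simp add: Digraph_Component.connected_def)
  then show ?thesis
    using commuting_graph_nonempty[OF assms]
    by (auto simp: strongly_connected_def reachable_apath[symmetric])
qed

end

theory Submission
  imports Defs
begin

text \<open>
  If a non-central element x had a non-abelian centralizer C(x), then for non-commuting a and b
  in C(x) the chain Z(G) < Z(C(x)) < C(x) \<inter> C(a) < C(x) < G would be strict, so that the index
  of Z(G) would be a product of at least four primes. Hence all centralizers of non-central elements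
  are abelian. Commuting is therefore transitive on non-central elements, and the connected component
  of x is contained in the proper subgroup C(x).
\<close>

text \<open>Taking a set \<open>S\<close> rather than a single element lets one notion cover the
  center of \<open>G\<close>, the centralizers of elements and, after intersection, the center of a
  centralizer.\<close>

definition centralizer :: "('a, 'b) monoid_scheme \<Rightarrow> 'a set \<Rightarrow> 'a set" where
  "centralizer G S = {g \<in> carrier G. \<forall>s \<in> S. g \<otimes>\<^bsub>G\<^esub> s = s \<otimes>\<^bsub>G\<^esub> g}"

lemma group_center_eq_centralizer: "group_center G = centralizer G (carrier G)"
  by (simp add: group_center_def centralizer_def)

lemma (in group) subgroup_centralizer:
  assumes "S \<subseteq> carrier G"
  shows "subgroup (centralizer G S) G"
proof (rule subgroupI)
  have s: "s \<in> carrier G" if "s \<in> S" for s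
    using assms that by blast
  show "centralizer G S \<subseteq> carrier G"
    by (auto simp: centralizer_def)
  show "centralizer G S \<noteq> {}"
  proof -
    have "\<one> \<in> centralizer G S"
      using s by (simp add: centralizer_def)
    then show ?thesis
      by blast
  qed
  show "inv g \<in> centralizer G S" if g: "g \<in> centralizer G S" for g
  proof -
    have "inv g \<otimes> t = t \<otimes> inv g" if "t \<in> S" for t
    proof -
      have c: "g \<in> carrier G" "t \<in> carrier G" "g \<otimes> t = t \<otimes> g"
        using g s that by (auto simp: centralizer_def)
      have "inv g \<otimes> t = inv g \<otimes> (t \<otimes> g) \<otimes> inv g"
        using c(1,2) by (simp add: m_assoc)
      also have "\<dots> = inv g \<otimes> (g \<otimes> t) \<otimes> inv g"
        using c(3) by simp
      also have "\<dots> = t \<otimes> inv g"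
        using c(1,2) by (simp add: m_assoc[symmetric])
      finally show ?thesis .
    qed
    then show ?thesis
      using g by (simp add: centralizer_def)
  qed
  show "g \<otimes> h \<in> centralizer G S" if g: "g \<in> centralizer G S" and h: "h \<in> centralizer G S" for g h
  proof -
    have "g \<otimes> h \<otimes> t = t \<otimes> (g \<otimes> h)" if "t \<in> S" for t
    proof -
      have c: "g \<in> carrier G" "h \<in> carrier G" "t \<in> carrier G"
        and gt: "g \<otimes> t = t \<otimes> g" and ht: "h \<otimes> t = t \<otimes> h"
        using g h s that by (auto simp: centralizer_def)
      have "g \<otimes> h \<otimes> t = g \<otimes> t \<otimes> h"
        using c ht by (simp add: m_assoc)
      also have "\<dots> = t \<otimes> (g \<otimes> h)"
        using c by (simp add: gt m_assoc)
      finally show ?thesis .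
    qed
    then show ?thesis
      using g h by (simp add: centralizer_def)
  qed
qed

lemma (in group) normal_group_center: "group_center G \<lhd> G"
  unfolding normal_inv_iff
proof (intro conjI ballI)
  show "subgroup (group_center G) G"
    by (simp add: group_center_eq_centralizer subgroup_centralizer)
next
  fix x z assume x: "x \<in> carrier G" and z: "z \<in> group_center G"
  then have "z \<in> carrier G" "x \<otimes> z = z \<otimes> x"
    by (auto simp: group_center_def)
  then have "x \<otimes> z \<otimes> inv x = z"
    using x by (simp add: m_assoc)
  with z show "x \<otimes> z \<otimes> inv x \<in> group_center G"
    by simp
qed

lemma (in group) card_subgroup_dvd:
  assumes "subgroup H G" "subgroup K G" "H \<subseteq> K"
  shows "card H dvd card K"
proof -
  interpret K: group "G\<lparr>carrier := K\<rparr>"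
    using assms(2) by (rule subgroup_imp_group)
  have "subgroup H (G\<lparr>carrier := K\<rparr>)"
    using assms by (rule subgroup_incl)
  from K.lagrange[OF this] have "card K = card (rcosets\<^bsub>G\<lparr>carrier := K\<rparr>\<^esub> H) * card H"
    by (simp add: order_def)
  then show ?thesis
    by (rule dvdI[OF trans[OF _ mult.commute]])
qed

text \<open>The size of \<open>prime_factorization\<close> counts prime factors with multiplicity,
  and a proper divisor lacks at least one of them.\<close>

lemma size_prime_factorization_less:
  fixes m n :: nat
  assumes "m dvd n" "m < n"
  shows "size (prime_factorization m) < size (prime_factorization n)"
proof -
  \<comment> \<open>Here \<open>m < n\<close> excludes \<open>n = 0\<close>, and then the divisor
    \<open>m\<close> of \<open>n\<close> is nonzero too.\<close>
  from assms have nz: "m \<noteq> 0" "n \<noteq> 0"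
    by auto
  then have "prod_mset (prime_factorization m) = m" "prod_mset (prime_factorization n) = n"
    by (simp_all add: prod_mset_prime_factorization_nat)
  with assms(2) have "prime_factorization m \<noteq> prime_factorization n"
    by auto
  then have "prime_factorization m \<subset># prime_factorization n"
    using nz assms(1) by (simp add: subset_mset.less_le prime_factorization_subset_iff_dvd)
  then show ?thesis
    by (rule mset_subset_size)
qed

text \<open>The images of \<open>A\<close> and \<open>B\<close> in \<open>G Mod H\<close> are finite
  subgroups, so Lagrange's theorem applies there even when \<open>G\<close> itself is infinite. The
  image of \<open>A\<close> has order |A:H|, and this number gains a prime factor at each strict
  inclusion above \<open>H\<close>.\<close>

lemma (in normal) size_prime_factorization_rcosets_less:
  assumes "finite (rcosets H)" "subgroup A G" "subgroup B G" "H \<subseteq> A" "A \<subset> B"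
  shows "size (prime_factorization (card ((#>) H ` A)))
    < size (prime_factorization (card ((#>) H ` B)))"
proof -
  interpret Q: group "G Mod H"
    by (rule factorgroup_is_group)
  interpret hom: group_hom G "G Mod H" "(#>) H"
    by unfold_locales (rule r_coset_hom_Mod)
  have "B \<subseteq> carrier G"
    using assms(3) by (rule subgroup.subset)
  obtain b where b: "b \<in> B" "b \<notin> A"
    using assms(5) by blast
  \<comment> \<open>The inclusion of images stays strict because \<open>A\<close> contains
    \<open>H\<close> and is thus a union of cosets of \<open>H\<close>: an element sharing a coset
    with some member of \<open>A\<close> lies in \<open>A\<close>.\<close>
  have "H #> b \<notin> (#>) H ` A"
  proof
    assume "H #> b \<in> (#>) H ` A"
    then obtain a where a: "a \<in> A" "H #> b = H #> a"
      by blast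
    have "b \<in> H #> b"
      using b \<open>B \<subseteq> carrier G\<close> by (intro rcos_self subgroup_axioms) auto
    then obtain h where "h \<in> H" "b = h \<otimes> a"
      using a by (auto simp: r_coset_def)
    then show False
      using a b assms(2,4) by (auto dest: subgroup.m_closed)
  qed
  then have "(#>) H ` A \<subset> (#>) H ` B"
    using b assms(5) by blast
  moreover have "finite ((#>) H ` B)"
    using assms(1) \<open>B \<subseteq> carrier G\<close>
    by (rule_tac finite_subset[of _ "rcosets H"]) (auto simp: RCOSETS_def)
  moreover have "card ((#>) H ` A) dvd card ((#>) H ` B)"
    using assms by (intro Q.card_subgroup_dvd hom.subgroup_img_is_subgroup image_mono) auto
  ultimately show ?thesis
    by (intro size_prime_factorization_less psubset_card_mono)
qed

lemma (in group) centralizer_commute: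
  assumes fin: "finite (rcosets (group_center G))"
    and size: "size (prime_factorization (card (rcosets (group_center G)))) \<le> 3"
    and x: "x \<in> carrier G" "x \<notin> group_center G"
    and a: "a \<in> centralizer G {x}" and b: "b \<in> centralizer G {x}"
  shows "a \<otimes> b = b \<otimes> a"
proof (rule ccontr)
  assume ab: "a \<otimes> b \<noteq> b \<otimes> a"
  let ?Z = "group_center G" and ?C = "centralizer G {x}"
  \<comment> \<open>\<open>?ZC\<close> is the center of \<open>?C\<close>, and \<open>?D\<close> is
    the centralizer of \<open>a\<close> inside \<open>?C\<close>. Written as intersections of
    centralizers taken in \<open>G\<close>, all terms of the chain are subgroups of
    \<open>G\<close>.\<close>
  let ?ZC = "?C \<inter> centralizer G ?C" and ?D = "?C \<inter> centralizer G {a}"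
  \<comment> \<open>The number of primes, with multiplicity, in the index of the center in
    \<open>A\<close>.\<close>
  let ?\<Omega> = "\<lambda>A. size (prime_factorization (card ((#>) ?Z ` A)))"
  interpret Z: normal ?Z G
    by (rule normal_group_center)
  have C: "?C \<subseteq> carrier G"
    by (auto simp: centralizer_def)
  have subC: "subgroup ?C G"
    using x(1) by (intro subgroup_centralizer) simp
  have subZC: "subgroup ?ZC G"
    by (intro subgroups_Inter_pair subC subgroup_centralizer C)
  have subD: "subgroup ?D G"
    using a C by (intro subgroups_Inter_pair subC subgroup_centralizer) blast
  have ZZC: "?Z \<subset> ?ZC"
  proof
    show "?Z \<subseteq> ?ZC"
      using x(1) unfolding group_center_def centralizer_def by blast
    \<comment> \<open>The element \<open>x\<close> is central in its own centralizer, but not in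
      \<open>G\<close>.\<close>
    have "x \<in> ?ZC"
      using x(1) by (auto simp: centralizer_def)
    with x(2) show "?Z \<noteq> ?ZC"
      by blast
  qed
  have ZCD: "?ZC \<subset> ?D"
  proof
    show "?ZC \<subseteq> ?D"
      using a unfolding centralizer_def by blast
    have "a \<in> ?D"
      using a by (simp add: centralizer_def)
    \<comment> \<open>The witness against centrality of \<open>a\<close> in \<open>?C\<close> is
      \<open>b\<close>, which also separates \<open>?D\<close> from \<open>?C\<close> below.\<close>
    moreover have "a \<notin> ?ZC"
      using b ab unfolding centralizer_def by blast
    ultimately show "?ZC \<noteq> ?D"
      by blast
  qed
  have "b \<notin> ?D"
    using ab unfolding centralizer_def by force
  then have DC: "?D \<subset> ?C"
    using b by blast
  have "?C \<noteq> carrier G"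
  proof
    assume "?C = carrier G"
    then have "\<forall>g \<in> carrier G. g \<otimes> x = x \<otimes> g"
      unfolding centralizer_def by blast
    then show False
      using x unfolding group_center_def by fastforce
  qed
  with C have CG: "?C \<subset> carrier G"
    by blast
  note less = Z.size_prime_factorization_rcosets_less[OF fin]
  \<comment> \<open>Four strict increases of a natural number force the value at
    \<open>carrier G\<close> to be at least 4.\<close>
  have "?\<Omega> ?Z < ?\<Omega> ?ZC"
    by (rule less[OF Z.subgroup_axioms subZC order_refl ZZC])
  moreover have "?\<Omega> ?ZC < ?\<Omega> ?D"
    using ZZC by (intro less[OF subZC subD _ ZCD]) blast
  moreover have "?\<Omega> ?D < ?\<Omega> ?C"
    using ZZC ZCD by (intro less[OF subD subC _ DC]) blast
  moreover have "?\<Omega> ?C < ?\<Omega> (carrier G)"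
    using ZZC by (intro less[OF subC subgroup_self _ CG]) blast
  moreover have "(#>) ?Z ` carrier G = rcosets ?Z"
    by (auto simp: RCOSETS_def)
  then have "?\<Omega> (carrier G) \<le> 3"
    using size by simp
  ultimately show False
    by linarith
qed

theorem theorem1p5:
  fixes G :: "('a, 'b) monoid_scheme" and ps :: "nat multiset"
  assumes "group G"
    and "\<not> comm_group G"
    and "finite (rcosets\<^bsub>G\<^esub> (group_center G))"
    and "card (rcosets\<^bsub>G\<^esub> (group_center G)) = prod_mset ps"
    and "\<forall>p \<in># ps. prime p"
    and "size ps \<le> 3"
  shows "\<not> Digraph_Component.connected (with_proj (commuting_graph G))"
proof
  assume conn: "Digraph_Component.connected (with_proj (commuting_graph G))"
  interpret group G
    by (rule assms(1))
  interpret pair_loopfree_digraph "commuting_graph G"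
    by (rule pair_loopfree_commuting_graph)
  \<comment> \<open>By unique factorization, the bound on \<open>size ps\<close> becomes a bound on
    the number of prime factors of the index.\<close>
  have "prime_factorization (prod_mset ps) = ps"
    using assms(5) by (intro prime_factorization_prod_mset_primes) auto
  then have size: "size (prime_factorization (card (rcosets\<^bsub>G\<^esub> (group_center G)))) \<le> 3"
    using assms(4,6) by simp
  obtain x where x: "x \<in> carrier G" "x \<notin> group_center G"
    using commuting_graph_nonempty[OF assms(1,2)] by (auto simp: commuting_graph_def)
  obtain y where y: "y \<in> carrier G" "x \<otimes>\<^bsub>G\<^esub> y \<noteq> y \<otimes>\<^bsub>G\<^esub> x"
    using x by (auto simp: group_center_def)
  have "y \<notin> group_center G"
    using x(1) y(2) unfolding group_center_def by force
  moreover have "x \<noteq> y"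
    using y(2) by blast
  ultimately have "x \<in> pverts (commuting_graph G)" "y \<in> pverts (commuting_graph G)" "x \<noteq> y"
    using x y by (simp_all add: commuting_graph_def)
  then have "x \<rightarrow>\<^sup>*\<^bsub>with_proj (commuting_graph G)\<^esub> y"
    using conn unfolding connected_commuting_graph_iff[OF assms(1,2)] reachable_apath by blast
  \<comment> \<open>Induction along a walk from \<open>x\<close>: every vertex reached commutes with
    \<open>x\<close>.\<close>
  then have "y \<in> centralizer G {x}"
  proof (induction rule: reachable_induct)
    case base
    show ?case
      using x by (simp add: centralizer_def)
  next
    case (step u v)
    then have uv: "u \<in> carrier G" "u \<notin> group_center G" "v \<in> carrier G" "u \<otimes>\<^bsub>G\<^esub> v = v \<otimes>\<^bsub>G\<^esub> u"
      by (auto simp: commuting_graph_def arcs_ends_def arc_to_ends_def)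
    \<comment> \<open>The abelian centralizer used here is that of the intermediate vertex
      \<open>u\<close>, which is non-central as an endpoint of an arc; it contains both
      \<open>x\<close> and \<open>v\<close>.\<close>
    have "x \<in> centralizer G {u}" "v \<in> centralizer G {u}"
      using x uv step.IH by (auto simp: centralizer_def)
    from centralizer_commute[OF assms(3) size uv(1,2) this] show ?case
      using uv(3) by (simp add: centralizer_def)
  qed
  with y show False
    by (simp add: centralizer_def)
qed

end
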